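(* Let $\mathbb{F}$ be any field, let $m\le n$, and let $G=([m]\cup[n],E)$ be a bipartite graph with $E\subseteq[m]\times[n]$, and let $\mathcal{S}_G=\langle \mathrm{E}_{i,j}\mid (i,j)\in E\rangle\le \mathrm{M}(m\times n,\mathbb{F})$. Then for each $r\in[m]$, the maximum order over induced subgraphs of $G$ whose matching number is at most $r$ equals the maximum order of an induced subspace of $\mathcal{S}_G$ in which every matrix has rank at most $r$.
   Context: $\mathrm{E}_{i,j}$ is the $m\times n$ matrix with a $1$ in position $(i,j)$ and zeros elsewhere. For $V_1\subseteq[m]$, $V_2\subseteq[n]$, the induced subgraph $G[V_1\cup V_2]$ has vertex set $V_1\cup V_2$ and edges $E\cap(V_1\times V_2)$; its order is $|V_1|+|V_2|$. For a matrix space $\mathcal{S}\le\mathrm{M}(m\times n,\mathbb{F})$ and subspaces $L\le\mathbb{F}^m$, $R\le\mathbb{F}^n$ (row vectors) of dimensions $s,t$, let $T_L$ (resp. $T_R$) be an $s\times m$ (resp. $t\times n$) matrix whose rows span $L$ (resp. $R$); the induced subspace is $\mathcal{S}[L,R]=\{T_LBT_R^t\mid B\in\mathcal{S}\}\le\mathrm{M}(s\times t,\mathbb{F})$ (well defined up to left-right equivalence), and its order is $s+t$. The matching number is the maximum number of pairwise vertex-disjoint edges. *)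

theory Defs
  imports "Jordan_Normal_Form.DL_Rank"
begin

section \<open>Bipartite graphs\<close>

text \<open>The two sides may share names of vertices: an edge \<open>(i, j)\<close> joins the left vertex \<open>i\<close> to the
  right vertex \<open>j\<close>, so the vertex set is the disjoint union of the two sides.\<close>

record ('a, 'b) bigraph =
  lverts :: "'a set"
  rverts :: "'b set"
  edges :: "('a \<times> 'b) set"

definition bigraph_order :: "('a, 'b) bigraph \<Rightarrow> nat" where
  "bigraph_order G = card (lverts G) + card (rverts G)"

definition induced_subgraph :: "('a, 'b) bigraph \<Rightarrow> 'a set \<Rightarrow> 'b set \<Rightarrow> ('a, 'b) bigraph" where
  "induced_subgraph G V1 V2 = \<lparr>lverts = V1, rverts = V2, edges = edges G \<inter> (V1 \<times> V2)\<rparr>"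

definition matching :: "('a, 'b) bigraph \<Rightarrow> ('a \<times> 'b) set \<Rightarrow> bool" where
  "matching G M \<longleftrightarrow> M \<subseteq> edges G \<and>
     (\<forall>e\<in>M. \<forall>f\<in>M. e \<noteq> f \<longrightarrow> fst e \<noteq> fst f \<and> snd e \<noteq> snd f)"

definition matching_number :: "('a, 'b) bigraph \<Rightarrow> nat" where
  "matching_number G = Max {card M | M. matching G M}"

lemma matching_sizes_finite_nonempty:
  assumes "finite (edges G)"
  shows "finite {card M | M. matching G M}" "{card M | M. matching G M} \<noteq> {}"
proof -
  have "{card M | M. matching G M} \<subseteq> card ` Pow (edges G)"
    by (auto simp: matching_def)
  then show "finite {card M | M. matching G M}"
    using assms by (meson finite_Pow_iff finite_imageI finite_subset)
  have "matching G {}"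
    by (simp add: matching_def)
  then show "{card M | M. matching G M} \<noteq> {}" by blast
qed

section \<open>Matrix spaces\<close>

text \<open>Matrices and vectors are indexed from 0, so \<open>{..<m}\<close> plays the role of \<open>[m]\<close>.\<close>

definition elem_mat :: "nat \<Rightarrow> nat \<Rightarrow> nat \<Rightarrow> nat \<Rightarrow> 'a::field mat" where
  "elem_mat m n i j = mat m n (\<lambda>(k, l). if k = i \<and> l = j then 1 else 0)"

definition graph_mat_space :: "nat \<Rightarrow> nat \<Rightarrow> (nat \<times> nat) set \<Rightarrow> 'a::field mat set" where
  "graph_mat_space m n E =
     LinearCombinations.module.span class_ring (module_mat TYPE('a) m n)
       {elem_mat m n i j | i j. (i, j) \<in> E}"

definition vec_subspace :: "nat \<Rightarrow> 'a::field vec set \<Rightarrow> bool" where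
  "vec_subspace m L \<longleftrightarrow> VectorSpace.subspace class_ring L (module_vec TYPE('a) m)"

definition subspace_dim :: "nat \<Rightarrow> 'a::field vec set \<Rightarrow> nat" where
  "subspace_dim m L = vectorspace.dim class_ring ((module_vec TYPE('a) m)\<lparr>carrier := L\<rparr>)"

text \<open>\<open>T\<close> has exactly \<open>dim L\<close> rows, so they form a basis of \<open>L\<close>.\<close>

definition spanning_matrix :: "nat \<Rightarrow> 'a::field vec set \<Rightarrow> 'a mat \<Rightarrow> bool" where
  "spanning_matrix m L T \<longleftrightarrow>
     T \<in> carrier_mat (subspace_dim m L) m \<and> vec_space.row_space m T = L"

text \<open>The matrices of \<open>S[L, R]\<close> in the coordinates given by a choice \<open>TL\<close>, \<open>TR\<close> of spanning matrices
  for \<open>L\<close> and \<open>R\<close>.\<close>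

definition induced_mat_space :: "'a::field mat set \<Rightarrow> 'a mat \<Rightarrow> 'a mat \<Rightarrow> 'a mat set" where
  "induced_mat_space S TL TR = {TL * B * TR\<^sup>T | B. B \<in> S}"

abbreviation mat_rank :: "'a::field mat \<Rightarrow> nat" where
  "mat_rank A \<equiv> vec_space.rank (dim_row A) A"

section \<open>The two sets of orders\<close>

definition induced_subgraph_orders :: "(nat, nat) bigraph \<Rightarrow> nat \<Rightarrow> nat set" where
  "induced_subgraph_orders G r =
     {bigraph_order (induced_subgraph G V1 V2) | V1 V2.
        V1 \<subseteq> lverts G \<and> V2 \<subseteq> rverts G \<and> matching_number (induced_subgraph G V1 V2) \<le> r}"

text \<open>The rank bound does not depend on the choice of \<open>TL\<close> and \<open>TR\<close>: another choice multiplies the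
  matrices of the induced subspace by invertible matrices on both sides.\<close>

definition induced_subspace_orders :: "nat \<Rightarrow> nat \<Rightarrow> 'a::field mat set \<Rightarrow> nat \<Rightarrow> nat set" where
  "induced_subspace_orders m n S r =
     {subspace_dim m L + subspace_dim n R | L R TL TR.
        vec_subspace m L \<and> vec_subspace n R \<and> spanning_matrix m L TL \<and> spanning_matrix n R TR \<and>
        (\<forall>A \<in> induced_mat_space S TL TR. mat_rank A \<le> r)}"

lemma induced_subgraph_orders_finite_nonempty:
  assumes "finite (lverts G)" "finite (rverts G)"
  shows "finite (induced_subgraph_orders G r)" "induced_subgraph_orders G r \<noteq> {}"
proof -
  have "induced_subgraph_orders G r \<subseteq>
      (\<lambda>(V1, V2). card V1 + card V2) ` (Pow (lverts G) \<times> Pow (rverts G))"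
    by (auto simp: induced_subgraph_orders_def bigraph_order_def induced_subgraph_def)
  then show "finite (induced_subgraph_orders G r)"
    using assms by (meson finite_Pow_iff finite_SigmaI finite_imageI finite_subset)
  have "{card M | M. matching (induced_subgraph G {} {}) M} = {0}"
    by (auto simp: matching_def induced_subgraph_def)
  then have "matching_number (induced_subgraph G {} {}) \<le> r"
    by (simp add: matching_number_def)
  then show "induced_subgraph_orders G r \<noteq> {}"
    by (auto simp: induced_subgraph_orders_def)
qed

lemma vec_subspace_dim_le:
  assumes "vec_subspace m (L :: 'a::field vec set)" "spanning_matrix m L T"
  shows "subspace_dim m L \<le> m"
proof -
  interpret vec_space "TYPE('a)" m .
  have "T \<in> carrier_mat (subspace_dim m L) m" and T: "span (set (rows T)) = L"
    using assms(2) by (auto simp: spanning_matrix_def row_space_def)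
  then have "vectorspace.fin_dim class_ring (vs L)"
    using fin_dim_span_rows by metis
  then show ?thesis
    using subspace_dim[of L] assms(1) dim_is_n fin_dim
    by (simp add: subspace_dim_def vec_subspace_def)
qed

lemma induced_subspace_orders_finite_nonempty:
  fixes S :: "'a::field mat set"
  assumes "S \<subseteq> carrier_mat m n"
  shows "finite (induced_subspace_orders m n S r)" "induced_subspace_orders m n S r \<noteq> {}"
proof -
  have "induced_subspace_orders m n S r \<subseteq> {..m + n}"
    using vec_subspace_dim_le by (fastforce simp: induced_subspace_orders_def intro: add_mono)
  then show "finite (induced_subspace_orders m n S r)"
    using finite_subset by blast
  have sub: "vec_subspace k {0\<^sub>v k :: 'a vec}" and "subspace_dim k {0\<^sub>v k :: 'a vec} = 0"
    and span: "spanning_matrix k {0\<^sub>v k} (0\<^sub>m 0 k :: 'a mat)" for k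
  proof -
    interpret vec_space "TYPE('a)" k .
    have sp: "span {} = {0\<^sub>v k :: 'a vec}"
      by (rule span_empty)
    show "vec_subspace k {0\<^sub>v k :: 'a vec}"
      using span_is_subspace[of "{}"] sp by (simp add: vec_subspace_def)
    show d: "subspace_dim k {0\<^sub>v k :: 'a vec} = 0"
      using dim_zero_vs sp by (simp add: subspace_dim_def)
    have "rows (0\<^sub>m 0 k :: 'a mat) = []" by (simp add: rows_def)
    then show "spanning_matrix k {0\<^sub>v k} (0\<^sub>m 0 k :: 'a mat)"
      using d sp by (simp add: spanning_matrix_def row_space_def)
  qed
  have "mat_rank A \<le> r" if A: "A \<in> induced_mat_space S (0\<^sub>m 0 m) (0\<^sub>m 0 n)" for A :: "'a mat"
  proof -
    have "A \<in> carrier_mat 0 0" using A assms by (auto simp: induced_mat_space_def)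
    then show ?thesis using vec_space.rank_le_nc[of A 0 0] by auto
  qed
  then show "induced_subspace_orders m n S r \<noteq> {}"
    using sub span unfolding induced_subspace_orders_def by blast
qed

end

(* The two sets of orders are in fact equal. A subgraph on V1, V2 gives the subspaces spanned by the
   corresponding unit vectors: if a matrix supported on the edges has rank k, one of its k-minors is
   nonzero, so some term of the Leibniz expansion is, and that term is a matching of size k.
   Conversely, given L and R, let V1 and V2 be the pivot columns of the reduced row echelon forms of
   TL and TR. For a matching M between V1 and V2, take B to be the sum of the E_ij over M; up to
   invertible factors on both sides, TL * B * TR^T is then a partial permutation matrix with card M
   ones, so its rank is at least card M over any field. *)

theory Submission
  imports Defs
begin

section \<open>Selection matrices\<close>

text \<open>Row \<open>a\<close> is the unit vector of index \<open>f a\<close>. A factor of this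
  form on the left picks rows and its transpose on the right picks columns, so submatrices become
  products that associativity can regroup.\<close>

definition selection_mat :: "nat \<Rightarrow> nat \<Rightarrow> (nat \<Rightarrow> nat) \<Rightarrow> 'a::field mat" where
  "selection_mat k m f = mat k m (\<lambda>(a, i). if i = f a then 1 else 0)"

lemma selection_mat_carrier [simp]: "selection_mat k m f \<in> carrier_mat k m"
  by (simp add: selection_mat_def)

lemma dim_selection_mat [simp]:
  "dim_row (selection_mat k m f) = k" "dim_col (selection_mat k m f) = m"
  by (simp_all add: selection_mat_def)

lemma selection_mat_mult:
  fixes A :: "'a::field mat"
  assumes "A \<in> carrier_mat m n" and "\<And>a. a < k \<Longrightarrow> f a < m"
  shows "selection_mat k m f * A = mat k n (\<lambda>(a, j). A $$ (f a, j))"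
proof (rule eq_matI)
  fix a j
  assume "a < dim_row (mat k n (\<lambda>(a, j). A $$ (f a, j)))"
    and "j < dim_col (mat k n (\<lambda>(a, j). A $$ (f a, j)))"
  then have a: "a < k" and j: "j < n" by auto
  have "(selection_mat k m f * A) $$ (a, j) = (\<Sum>i = 0..<m. (if i = f a then 1 else 0) * A $$ (i, j))"
    using a j assms(1) by (auto simp: selection_mat_def scalar_prod_def intro!: sum.cong)
  also have "\<dots> = (\<Sum>i = 0..<m. if i = f a then A $$ (i, j) else 0)"
    by (intro sum.cong) auto
  also have "\<dots> = A $$ (f a, j)"
    using assms(2)[OF a] by (simp add: sum.delta')
  finally show "(selection_mat k m f * A) $$ (a, j) = mat k n (\<lambda>(a, j). A $$ (f a, j)) $$ (a, j)"
    using a j by simp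
qed (use assms in auto)

lemma mult_selection_mat_transpose:
  fixes A :: "'a::field mat"
  assumes A: "A \<in> carrier_mat n m" and f: "\<And>a. a < k \<Longrightarrow> f a < m"
  shows "A * (selection_mat k m f)\<^sup>T = mat n k (\<lambda>(i, a). A $$ (i, f a))"
proof -
  have "A * (selection_mat k m f)\<^sup>T = (selection_mat k m f * A\<^sup>T)\<^sup>T"
    using A by (subst transpose_mult[of _ k m _ n]) auto
  also have "\<dots> = mat n k (\<lambda>(i, a). A $$ (i, f a))"
    using A f by (subst selection_mat_mult[of _ m n]) auto
  finally show ?thesis .
qed

lemma selection_mat_comp:
  assumes "\<And>a. a < k \<Longrightarrow> b a < s"
  shows "selection_mat k s b * selection_mat s m f = (selection_mat k m (f \<circ> b) :: 'a::field mat)"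
  using assms by (subst selection_mat_mult[of _ s m]) (auto simp: selection_mat_def)

text \<open>Distinct unit vectors are orthonormal over every field; injectivity of \<open>b\<close>
  makes the off-diagonal entries vanish.\<close>

lemma selection_mat_right_inverse:
  assumes "\<And>a. a < k \<Longrightarrow> b a < s" and "inj_on b {..<k}"
  shows "selection_mat k s b * (selection_mat k s b)\<^sup>T = (1\<^sub>m k :: 'a::field mat)"
  using assms
  by (subst mult_selection_mat_transpose[of _ k s])
    (auto simp: selection_mat_def inj_on_def)

section \<open>Rank, kernels and matchings\<close>

lemma mult_mat_unit_vec:
  fixes A :: "'a::field mat"
  assumes "A \<in> carrier_mat n nc" and "i < nc"
  shows "A *\<^sub>v unit_vec nc i = col A i"
  using assms by (intro eq_vecI) (auto simp: scalar_prod_right_unit)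

section \<open>Rank, kernels and one-sided inverses\<close>

context vec_space
begin

text \<open>Supplies the set by which \<open>rank_card_indpt\<close> reads the rank as a number of
  columns. The extension starts from the empty set, independent as a subset of a finite
  basis.\<close>

lemma obtains_maximal_indpt_cols:
  obtains U where "maximal U (\<lambda>T. T \<subseteq> set (cols A) \<and> lin_indpt T)"
proof -
  have "lin_indpt {}"
    by (metis empty_subsetI fin_dim finite_basis_exists subset_li_is_li vec_vs vectorspace.basis_def)
  then obtain U where "maximal U (\<lambda>T. T \<subseteq> set (cols A) \<and> lin_indpt T)"
    using maximal_exists_superset[of "set (cols A)" "\<lambda>T. T \<subseteq> set (cols A) \<and> lin_indpt T" "{}"]
    by auto
  then show thesis by (rule that)
qed

lemma rank_eq_dim_col_if_trivial_kernel:
  assumes A: "A \<in> carrier_mat n nc"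
    and ker: "\<And>v. v \<in> carrier_vec nc \<Longrightarrow> A *\<^sub>v v = 0\<^sub>v n \<Longrightarrow> v = 0\<^sub>v nc"
  shows "rank A = nc"
proof -
  \<comment> \<open>Independence concerns the set of columns, so repetitions in the list are
    excluded first: two equal columns would put a difference of two unit vectors into the
    kernel.\<close>
  have dist: "distinct (cols A)"
  proof (rule ccontr)
    assume "\<not> distinct (cols A)"
    then obtain i j where ij: "i < nc" "j < nc" "i \<noteq> j" "col A i = col A j"
      using A by (auto simp: distinct_conv_nth)
    let ?v = "unit_vec nc i - unit_vec nc j :: 'a vec"
    have "A *\<^sub>v ?v = A *\<^sub>v unit_vec nc i - A *\<^sub>v unit_vec nc j"
      using A by (intro mult_minus_distrib_mat_vec) auto
    also have "\<dots> = 0\<^sub>v n"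
      using A ij by (simp add: mult_mat_unit_vec)
    finally have "?v = 0\<^sub>v nc" by (intro ker) auto
    then have "?v $ i = 0\<^sub>v nc $ i" by simp
    then show False using ij by simp
  qed
  then have "lin_indpt (set (cols A))"
    using lin_depE[OF A _ dist] ker by metis
  then show ?thesis using lin_indpt_full_rank[OF A dist] by simp
qed

lemma trivial_kernel_if_rank_eq_dim_col:
  assumes A: "A \<in> carrier_mat n nc" and rank: "rank A = nc"
    and v: "v \<in> carrier_vec nc" "A *\<^sub>v v = 0\<^sub>v n"
  shows "v = 0\<^sub>v nc"
proof -
  obtain U where U: "maximal U (\<lambda>T. T \<subseteq> set (cols A) \<and> lin_indpt T)"
    by (rule obtains_maximal_indpt_cols)
  then have "U \<subseteq> set (cols A)" by (simp add: maximal_def)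
  \<comment> \<open>The rank \<open>nc\<close> is the size of \<open>U\<close>, so the list of
    \<open>nc\<close> columns has at least \<open>nc\<close> different members and hence no
    repetition.\<close>
  then have "card U \<le> card (set (cols A))" by (simp add: card_mono)
  then have "nc \<le> card (set (cols A))" using rank_card_indpt[OF A U] rank by simp
  then have dist: "distinct (cols A)"
    using A card_length[of "cols A"] by (intro card_distinct) auto
  show ?thesis
    using full_rank_lin_indpt[OF A rank dist] lin_depI[OF A v(1) _ v(2) dist] by blast
qed

text \<open>The column space of the product lies in that of \<open>A\<close>. The dimensions are
  compared with the column space of \<open>A\<close> as the ambient space.\<close>

lemma rank_mult_le:
  assumes A: "A \<in> carrier_mat n nc" and Y: "Y \<in> carrier_mat nc k"
  shows "rank (A * Y) \<le> rank A"
proof -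
  have AY: "A * Y \<in> carrier_mat n k" using A Y by simp
  have "col_space (A * Y) \<subseteq> col_space A"
  proof
    fix w assume "w \<in> col_space (A * Y)"
    then obtain x where "x \<in> carrier_vec k" "w = (A * Y) *\<^sub>v x"
      using col_space_eq[OF AY] AY by auto
    then have "w = A *\<^sub>v (Y *\<^sub>v x)" "Y *\<^sub>v x \<in> carrier_vec nc" "w \<in> carrier_vec n"
      using A Y by (auto simp: assoc_mult_mat_vec)
    then show "w \<in> col_space A" using col_space_eq[OF A] A by auto
  qed
  then have sub: "span (set (cols (A * Y))) \<subseteq> span (set (cols A))"
    by (simp add: col_space_def)
  have carr: "set (cols A) \<subseteq> carrier_vec n" "set (cols (A * Y)) \<subseteq> carrier_vec n"
    using cols_dim A AY by blast+
  have "vectorspace class_ring (vs (span (set (cols A))))"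
    using carr(1) span_is_subspace subspace_is_vs by blast
  then have "vectorspace.dim class_ring ((vs (span (set (cols A))))\<lparr>carrier := span (set (cols (A * Y)))\<rparr>)
    \<le> vectorspace.dim class_ring (vs (span (set (cols A))))"
  proof (rule vectorspace.subspace_dim)
    show "subspace class_ring (span (set (cols (A * Y)))) (vs (span (set (cols A))))"
      using nested_subspaces[OF _ _ sub] carr span_is_subspace by blast
    show "vectorspace.fin_dim class_ring (vs (span (set (cols A))))"
      using fin_dim_span_cols[OF A] .
    show "vectorspace.fin_dim class_ring
        ((vs (span (set (cols A))))\<lparr>carrier := span (set (cols (A * Y)))\<rparr>)"
      using fin_dim_span_cols[OF AY] by simp
  qed
  then show ?thesis by (simp add: rank_def)
qed

text \<open>\<open>X\<close> is a left inverse of \<open>A * Y\<close>, so \<open>A * Y\<close> has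
  trivial kernel and rank \<open>k\<close>; multiplication by \<open>Y\<close> cannot have raised
  the rank.\<close>

lemma rank_ge_if_identity_factor:
  assumes A: "A \<in> carrier_mat n nc" and X: "X \<in> carrier_mat k n" and Y: "Y \<in> carrier_mat nc k"
    and one: "X * (A * Y) = 1\<^sub>m k"
  shows "k \<le> rank A"
proof -
  have AY: "A * Y \<in> carrier_mat n k" using A Y by simp
  have "rank (A * Y) = k"
  proof (rule rank_eq_dim_col_if_trivial_kernel[OF AY])
    fix v assume v: "v \<in> carrier_vec k" "(A * Y) *\<^sub>v v = 0\<^sub>v n"
    have "v = (X * (A * Y)) *\<^sub>v v" using v one by simp
    also have "\<dots> = X *\<^sub>v ((A * Y) *\<^sub>v v)" using X AY v by (intro assoc_mult_mat_vec) auto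
    finally show "v = 0\<^sub>v k" using v X by auto
  qed
  then show ?thesis using rank_mult_le[OF A Y] by simp
qed

end

text \<open>The selected columns are the pivot columns of the reduced row echelon form \<open>P * T\<close>.\<close>

lemma trivial_left_kernel_obtains_selection:
  fixes T :: "'a::field mat"
  assumes T: "T \<in> carrier_mat s m"
    and ker: "\<And>v. v \<in> carrier_vec s \<Longrightarrow> T\<^sup>T *\<^sub>v v = 0\<^sub>v m \<Longrightarrow> v = 0\<^sub>v s"
  obtains P f where "P \<in> carrier_mat s s" and "inj_on f {..<s}" and "\<And>a. a < s \<Longrightarrow> f a < m"
    and "P * (T * (selection_mat s m f)\<^sup>T) = 1\<^sub>m s"
proof -
  define C where "C = gauss_jordan_single T"
  have C: "C \<in> carrier_mat s m" and ref: "row_echelon_form C"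
    using gauss_jordan_single(2,3)[OF T] C_def by auto
  obtain P Q where P: "P \<in> carrier_mat s s" and Q: "Q \<in> carrier_mat s s"
    and CP: "C = P * T" and PQ: "P * Q = 1\<^sub>m s"
    using gauss_jordan_single(4)[OF T C_def[symmetric]] by blast
  obtain f where piv: "pivot_fun C f m"
    using ref C unfolding row_echelon_form_def by auto
  note pD = pivot_funD[OF carrier_matD(1)[OF C] piv]
  have fm: "f a < m" if a: "a < s" for a
  proof (rule ccontr)
    assume "\<not> f a < m"
    \<comment> \<open>A pivot function takes the value \<open>m\<close>, one past the last column,
      exactly at the zero rows. Such a row of \<open>C\<close> puts
      \<open>P\<^sup>T *\<^sub>v ?e\<close> into the kernel of \<open>T\<^sup>T\<close>.\<close>
    then have "f a = m" using pD(1)[OF a] by simp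
    then have row0: "row C a = 0\<^sub>v m" using pivot_fun_zero_row_iff[OF piv C a] by simp
    let ?e = "unit_vec s a :: 'a vec"
    have "T\<^sup>T *\<^sub>v (P\<^sup>T *\<^sub>v ?e) = (T\<^sup>T * P\<^sup>T) *\<^sub>v ?e"
      using T P by (intro assoc_mult_mat_vec[symmetric]) auto
    also have "\<dots> = C\<^sup>T *\<^sub>v ?e" using T P CP by (simp add: transpose_mult)
    also have "\<dots> = row C a" using mult_mat_unit_vec[of "C\<^sup>T" m s a] C a by simp
    finally have P0: "P\<^sup>T *\<^sub>v ?e = 0\<^sub>v s" using row0 P by (intro ker) auto
    \<comment> \<open>\<open>Q\<^sup>T\<close> is a left inverse of \<open>P\<^sup>T\<close>, so
      \<open>P\<^sup>T\<close> cannot annihilate a unit vector.\<close>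
    have "?e = (P * Q)\<^sup>T *\<^sub>v ?e" using PQ by simp
    also have "\<dots> = (Q\<^sup>T * P\<^sup>T) *\<^sub>v ?e" using P Q by (simp add: transpose_mult)
    also have "\<dots> = Q\<^sup>T *\<^sub>v (P\<^sup>T *\<^sub>v ?e)"
      using P Q by (intro assoc_mult_mat_vec) auto
    also have "\<dots> = 0\<^sub>v s" using Q P0 by auto
    finally have "?e $ a = 0\<^sub>v s $ a" by simp
    then show False using a by simp
  qed
  show thesis
  proof
    show "P \<in> carrier_mat s s" by (rule P)
    show "f a < m" if "a < s" for a using fm that .
    show "inj_on f {..<s}"
    proof (rule inj_onI)
      fix a b assume ab: "a \<in> {..<s}" "b \<in> {..<s}" "f a = f b"
      show "a = b"
      proof (rule ccontr)
        assume "a \<noteq> b"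
        \<comment> \<open>A pivot column is zero outside its pivot row, so two rows cannot share
          one.\<close>
        then have "C $$ (a, f b) = 0" using ab fm pD(5)[of b a] by auto
        moreover have "C $$ (a, f a) = 1" using ab fm pD(4)[of a] by auto
        ultimately show False using ab by simp
      qed
    qed
    \<comment> \<open>Taken in the order of their rows, the pivot columns of \<open>C\<close> are
      the unit vectors.\<close>
    have "P * (T * (selection_mat s m f)\<^sup>T) = C * (selection_mat s m f)\<^sup>T"
      using P T CP by (simp add: assoc_mult_mat[of _ s s _ m _ s])
    also have "\<dots> = 1\<^sub>m s"
      using C fm pD(4,5) by (subst mult_selection_mat_transpose[of _ s m]) auto
    finally show "P * (T * (selection_mat s m f)\<^sup>T) = 1\<^sub>m s" .
  qed
qed

section \<open>Matchings in the support of a matrix\<close>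

text \<open>A nonzero Leibniz sum has a nonzero term, and a nonzero product has no zero
  factor.\<close>

lemma det_nonzero_obtains_permutation:
  fixes D :: "'a::field mat"
  assumes D: "D \<in> carrier_mat k k" and "det D \<noteq> 0"
  obtains p where "p permutes {0..<k}" and "\<And>a. a < k \<Longrightarrow> D $$ (a, p a) \<noteq> 0"
proof -
  have "(\<Sum>p\<in>{p. p permutes {0..<k}}. signof p * (\<Prod>i = 0..<k. D $$ (i, p i))) \<noteq> 0"
    using assms det_def'[OF D] by simp
  then obtain p where p: "p permutes {0..<k}" "signof p * (\<Prod>i = 0..<k. D $$ (i, p i)) \<noteq> 0"
    by (metis (mono_tags, lifting) mem_Collect_eq sum.neutral)
  then have "\<forall>i\<in>{0..<k}. D $$ (i, p i) \<noteq> 0" by auto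
  with p(1) show thesis by (auto intro!: that)
qed

text \<open>Independent columns, as many as the rank, form \<open>C\<close>. Reducing
  \<open>C\<^sup>T\<close> selects equally many rows on which the minor is invertible, and a nonzero
  Leibniz term of that minor uses each of its rows and columns once.\<close>

lemma (in vec_space) rank_obtains_support_matching:
  assumes A: "A \<in> carrier_mat n nc"
  obtains M where "finite M" and "card M = rank A"
    and "M \<subseteq> {(i, j). i < n \<and> j < nc \<and> A $$ (i, j) \<noteq> 0}"
    and "inj_on fst M" and "inj_on snd M"
proof -
  define k where "k = rank A"
  obtain U where U: "maximal U (\<lambda>T. T \<subseteq> set (cols A) \<and> lin_indpt T)"
    by (rule obtains_maximal_indpt_cols)
  then have Usub: "U \<subseteq> set (cols A)" and Ulin: "lin_indpt U" by (auto simp: maximal_def)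
  obtain xs where xs: "set xs = U" "distinct xs"
    using finite_distinct_list Usub finite_subset by (metis List.finite_set)
  have len: "length xs = k"
    using rank_card_indpt[OF A U] xs distinct_card k_def by metis
  have "\<forall>a<k. \<exists>j<nc. xs ! a = col A j"
    using Usub xs(1) len A by (force simp: set_conv_nth)
  then obtain g where g: "\<And>a. a < k \<Longrightarrow> g a < nc" "\<And>a. a < k \<Longrightarrow> xs ! a = col A (g a)"
    by metis
  have ginj: "inj_on g {..<k}"
    using g xs(2) len by (auto simp: inj_on_def) (metis nth_eq_iff_index_eq)
  define C where "C = mat_of_cols n xs"
  have xsc: "set xs \<subseteq> carrier_vec n" using xs Usub A cols_dim by blast
  have C: "C \<in> carrier_mat n k" using len by (auto simp: C_def)
  have "rank C = k"
    using lin_indpt_full_rank[OF C] xs xsc Ulin by (simp add: C_def)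
  then have ker: "\<And>v. v \<in> carrier_vec k \<Longrightarrow> (C\<^sup>T)\<^sup>T *\<^sub>v v = 0\<^sub>v n \<Longrightarrow> v = 0\<^sub>v k"
    using trivial_kernel_if_rank_eq_dim_col[OF C] by simp
  have Ct: "C\<^sup>T \<in> carrier_mat k n" using C by simp
  obtain P f where P: "P \<in> carrier_mat k k" and finj: "inj_on f {..<k}"
    and f: "\<And>a. a < k \<Longrightarrow> f a < n" and one: "P * (C\<^sup>T * (selection_mat k n f)\<^sup>T) = 1\<^sub>m k"
    using trivial_left_kernel_obtains_selection[OF Ct ker] by metis
  define D where "D = C\<^sup>T * (selection_mat k n f)\<^sup>T"
  have D: "D \<in> carrier_mat k k" using Ct by (simp add: D_def)
  have "det P * det D = 1" using det_mult[OF P D] one D_def by simp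
  then have "det D \<noteq> 0" by auto
  then obtain p where p: "p permutes {0..<k}" "\<And>a. a < k \<Longrightarrow> D $$ (a, p a) \<noteq> 0"
    using det_nonzero_obtains_permutation[OF D] by metis
  have pk: "p a < k" if "a < k" for a using permutes_in_image[OF p(1), of a] that by simp
  \<comment> \<open>\<open>D\<close> is the transpose of a submatrix of \<open>A\<close>, so its row
    index runs through the columns \<open>g\<close> and its column index through the rows
    \<open>f\<close>. This is why \<open>p\<close> is applied under \<open>f\<close> in
    \<open>M\<close>.\<close>
  have entry: "D $$ (a, b) = A $$ (f b, g a)" if "a < k" "b < k" for a b
  proof -
    have "D $$ (a, b) = C $$ (f b, a)"
      using that f C Ct by (simp add: D_def mult_selection_mat_transpose[of _ k n])
    also have "\<dots> = A $$ (f b, g a)"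
      using that f[of b] g[of a] len A by (simp add: C_def mat_of_cols_def)
    finally show ?thesis .
  qed
  define M where "M = (\<lambda>a. (f (p a), g a)) ` {..<k}"
  have fpinj: "inj_on (\<lambda>a. f (p a)) {..<k}"
    using inj_onD[OF finj] pk injD[OF permutes_inj[OF p(1)]] by (intro inj_onI) (meson lessThan_iff)
  show thesis
  proof
    show "finite M" by (simp add: M_def)
    show "card M = rank A"
      unfolding M_def using ginj k_def by (subst card_image) (auto simp: inj_on_def)
    show "M \<subseteq> {(i, j). i < n \<and> j < nc \<and> A $$ (i, j) \<noteq> 0}"
      using f g(1) pk p(2) entry by (auto simp: M_def)
    show "inj_on fst M" using fpinj by (auto simp: M_def inj_on_def)
    show "inj_on snd M" using ginj by (auto simp: M_def inj_on_def)
  qed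
qed

section \<open>The matrix space of a graph\<close>

lemma elem_mat_carrier [simp]: "elem_mat m n i j \<in> carrier_mat m n"
  by (simp add: elem_mat_def)

text \<open>The set \<open>?N\<close> is closed under the module operations and contains all
  generators, so it contains their span.\<close>

lemma graph_mat_space_support:
  fixes B :: "'a::field mat"
  assumes "B \<in> graph_mat_space m n E"
  shows "B \<in> carrier_mat m n"
    and "\<And>i j. i < m \<Longrightarrow> j < n \<Longrightarrow> (i, j) \<notin> E \<Longrightarrow> B $$ (i, j) = 0"
proof -
  interpret vectorspace "class_ring :: 'a ring" "module_mat TYPE('a) m n" by (rule matrix_vs)
  let ?N = "{B :: 'a mat. B \<in> carrier_mat m n \<and> (\<forall>i<m. \<forall>j<n. (i, j) \<notin> E \<longrightarrow> B $$ (i, j) = 0)}"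
  have "LinearCombinations.submodule class_ring ?N (module_mat TYPE('a) m n)"
    by (rule LinearCombinations.submodule.intro[OF module_axioms]) (auto simp: module_mat_simps)
  moreover have "{elem_mat m n i j | i j. (i, j) \<in> E} \<subseteq> ?N"
    by (auto simp: elem_mat_def)
  ultimately have "graph_mat_space m n E \<subseteq> ?N"
    unfolding graph_mat_space_def by (intro span_is_subset)
  then show "B \<in> carrier_mat m n"
    and "\<And>i j. i < m \<Longrightarrow> j < n \<Longrightarrow> (i, j) \<notin> E \<Longrightarrow> B $$ (i, j) = 0"
    using assms by blast+
qed

text \<open>The 0/1 matrix of \<open>M\<close> is the sum of the elementary matrices over
  \<open>M\<close>, built up one edge at a time.\<close>

lemma indicator_mat_in_graph_mat_space:
  assumes "finite M" and "M \<subseteq> E"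
  shows "mat m n (\<lambda>(i, j). if (i, j) \<in> M then 1 else 0) \<in> (graph_mat_space m n E :: 'a::field mat set)"
proof -
  interpret vectorspace "class_ring :: 'a ring" "module_mat TYPE('a) m n" by (rule matrix_vs)
  let ?U = "{elem_mat m n i j | i j. (i, j) \<in> E} :: 'a mat set"
  have U: "?U \<subseteq> carrier (module_mat TYPE('a) m n)" by (auto simp: module_mat_simps)
  show ?thesis
    using assms unfolding graph_mat_space_def
  proof (induction M rule: finite_induct)
    case empty
    have "mat m n (\<lambda>(i, j). if (i, j) \<in> {} then 1 else 0) = (0\<^sub>m m n :: 'a mat)"
      by auto
    then show ?case
      using span_zero[of ?U] by (simp only: module_mat_simps)
  next
    case (insert e M)
    obtain i j where e: "e = (i, j)" by force
    \<comment> \<open>No entry becomes 1 + 1, because \<open>e\<close> is not in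
      \<open>M\<close>.\<close>
    have "(mat m n (\<lambda>(k, l). if (k, l) \<in> insert e M then 1 else 0) :: 'a mat)
        = elem_mat m n i j + mat m n (\<lambda>(k, l). if (k, l) \<in> M then 1 else 0)"
      using insert.hyps e by (auto simp: elem_mat_def)
    moreover have "elem_mat m n i j \<in> span ?U"
      using in_own_span[OF U] insert.prems e by auto
    moreover have "mat m n (\<lambda>(k, l). if (k, l) \<in> M then 1 else 0) \<in> span ?U"
      using insert.IH insert.prems by blast
    ultimately show ?case
      using span_add1[OF U] by (simp only: module_mat_simps)
  qed
qed


text \<open>A finite edge set has finitely many matching sizes, and the empty matching provides one,
  so \<open>Max\<close> is a genuine maximum.\<close>

lemma matching_number_le_iff:
  assumes "finite (edges G)"
  shows "matching_number G \<le> r \<longleftrightarrow> (\<forall>M. matching G M \<longrightarrow> card M \<le> r)"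
  unfolding matching_number_def
  using Max_le_iff[OF matching_sizes_finite_nonempty[OF assms]] by blast

lemma matching_iff_inj_on:
  "matching G M \<longleftrightarrow> M \<subseteq> edges G \<and> inj_on fst M \<and> inj_on snd M"
  unfolding matching_def inj_on_def by blast

section \<open>Comparing the two sets of orders\<close>

text \<open>The rank is the dimension of the span of the columns, and the columns of
  \<open>T\<^sup>T\<close> are the rows of \<open>T\<close>.\<close>

lemma subspace_dim_row_space:
  "subspace_dim m (vec_space.row_space m T) = vec_space.rank m (T\<^sup>T :: 'a::field mat)"
proof -
  interpret vec_space "TYPE('a)" m .
  show ?thesis by (simp add: subspace_dim_def row_space_def rank_def)
qed

section \<open>From induced subgraphs to induced subspaces\<close>

text \<open>\<open>L\<close> is the coordinate subspace of the indices \<open>f a\<close>. Since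
  \<open>?T * ?T\<^sup>T\<close> is the identity, the rows are independent, and their number is the
  dimension, as \<open>spanning_matrix\<close> demands.\<close>

lemma selection_mat_spans:
  assumes inj: "inj_on f {..<k}" and f: "\<And>a. a < k \<Longrightarrow> f a < m"
  obtains L :: "'a::field vec set" where "vec_subspace m L" and "subspace_dim m L = k"
    and "spanning_matrix m L (selection_mat k m f)"
proof -
  interpret vec_space "TYPE('a)" m .
  let ?T = "selection_mat k m f :: 'a mat"
  have "rank ?T\<^sup>T = k"
  proof (rule rank_eq_dim_col_if_trivial_kernel)
    fix v assume v: "v \<in> carrier_vec k" "?T\<^sup>T *\<^sub>v v = 0\<^sub>v m"
    have "v = (?T * ?T\<^sup>T) *\<^sub>v v"
      using v selection_mat_right_inverse[OF f inj, where 'a='a] by simp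
    also have "\<dots> = ?T *\<^sub>v (?T\<^sup>T *\<^sub>v v)"
      using v by (intro assoc_mult_mat_vec[of _ k m _ k]) auto
    also have "\<dots> = 0\<^sub>v k" using v(2) by (intro eq_vecI) auto
    finally show "v = 0\<^sub>v k" .
  qed auto
  then have dim: "subspace_dim m (row_space ?T) = k"
    by (simp add: subspace_dim_row_space)
  have "vec_subspace m (row_space ?T)"
    unfolding vec_subspace_def row_space_def
    using rows_carrier[of ?T] by (intro span_is_subspace) auto
  moreover have "spanning_matrix m (row_space ?T) ?T"
    using dim by (simp add: spanning_matrix_def)
  ultimately show thesis using dim that by blast
qed

text \<open>For coordinate subspaces the induced matrices are submatrices of members of
  \<open>S\<close>, so a matching in their support is a matching of the induced subgraph.\<close>

lemma subgraph_orders_subset: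
  fixes S :: "'a::field mat set"
  assumes E: "E \<subseteq> {..<m} \<times> {..<n}"
    and G: "G = \<lparr>lverts = {..<m}, rverts = {..<n}, edges = E\<rparr>"
    and S: "S = graph_mat_space m n E"
  shows "induced_subgraph_orders G r \<subseteq> induced_subspace_orders m n S r"
proof
  fix d assume "d \<in> induced_subgraph_orders G r"
  then obtain V1 V2 where V: "V1 \<subseteq> {..<m}" "V2 \<subseteq> {..<n}"
    and d: "d = card V1 + card V2" and mn: "matching_number (induced_subgraph G V1 V2) \<le> r"
    by (auto simp: induced_subgraph_orders_def bigraph_order_def induced_subgraph_def G)
  have finE: "finite E" using E by (metis finite_SigmaI finite_lessThan finite_subset)
  have finV: "finite V1" "finite V2" using V finite_subset by blast+
  obtain f where f: "bij_betw f {..<card V1} V1"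
    using ex_bij_betw_nat_finite[OF finV(1)] by (auto simp: lessThan_atLeast0)
  obtain g where g: "bij_betw g {..<card V2} V2"
    using ex_bij_betw_nat_finite[OF finV(2)] by (auto simp: lessThan_atLeast0)
  have fV: "f a \<in> V1" if "a < card V1" for a using f that by (auto simp: bij_betw_def)
  have gV: "g a \<in> V2" if "a < card V2" for a using g that by (auto simp: bij_betw_def)
  have fm: "f a < m" if "a < card V1" for a using fV V(1) that by auto
  have gn: "g a < n" if "a < card V2" for a using gV V(2) that by auto
  have finj: "inj_on f {..<card V1}" and ginj: "inj_on g {..<card V2}"
    using f g by (auto simp: bij_betw_def)
  let ?TL = "selection_mat (card V1) m f :: 'a mat"
  let ?TR = "selection_mat (card V2) n g :: 'a mat"
  obtain L where L: "vec_subspace m L" "subspace_dim m L = card V1" "spanning_matrix m L ?TL"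
    by (rule selection_mat_spans[OF finj fm])
  obtain R where R: "vec_subspace n R" "subspace_dim n R = card V2" "spanning_matrix n R ?TR"
    by (rule selection_mat_spans[OF ginj gn])
  have "mat_rank A \<le> r" if A_in: "A \<in> induced_mat_space S ?TL ?TR" for A
  proof -
    obtain B where B: "B \<in> S" and A: "A = ?TL * B * ?TR\<^sup>T"
      using A_in by (auto simp: induced_mat_space_def)
    have Bc: "B \<in> carrier_mat m n"
      and B0: "\<And>i j. i < m \<Longrightarrow> j < n \<Longrightarrow> (i, j) \<notin> E \<Longrightarrow> B $$ (i, j) = 0"
      using graph_mat_space_support[of B m n E] B S by auto
    have Aeq: "A = mat (card V1) (card V2) (\<lambda>(a, b). B $$ (f a, g b))"
      unfolding A using fm gn Bc
      by (subst mult_selection_mat_transpose[of _ "card V1" n])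
        (auto simp: selection_mat_mult[of _ m n])
    then have Ac: "A \<in> carrier_mat (card V1) (card V2)" by simp
    \<comment> \<open>\<open>mat_rank\<close> takes the number of rows as the dimension of the
      ambient space.\<close>
    interpret vec_space "TYPE('a)" "card V1" .
    obtain M where M: "finite M" "card M = rank A"
      "M \<subseteq> {(i, j). i < card V1 \<and> j < card V2 \<and> A $$ (i, j) \<noteq> 0}" "inj_on fst M" "inj_on snd M"
      by (rule rank_obtains_support_matching[OF Ac])
    \<comment> \<open>\<open>M\<close> consists of positions inside the submatrix; \<open>f\<close>
      and \<open>g\<close> translate them into vertices. Both are injective, so disjointness and
      cardinality survive.\<close>
    define N where "N = (\<lambda>p. (f (fst p), g (snd p))) ` M"
    have M_entry: "fst p < card V1" "snd p < card V2" "B $$ (f (fst p), g (snd p)) \<noteq> 0"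
      if "p \<in> M" for p
      using M(3) that by (auto simp: Aeq)
    have f_eqD: "p = q" if "p \<in> M" "q \<in> M" "f (fst p) = f (fst q)" for p q
      using that inj_onD[OF finj, of "fst p" "fst q"] inj_onD[OF M(4)] M_entry(1) by simp
    have g_eqD: "p = q" if "p \<in> M" "q \<in> M" "g (snd p) = g (snd q)" for p q
      using that inj_onD[OF ginj, of "snd p" "snd q"] inj_onD[OF M(5)] M_entry(2) by simp
    have "N \<subseteq> E \<inter> (V1 \<times> V2)"
    proof
      fix x assume "x \<in> N"
      then obtain p where p: "p \<in> M" "x = (f (fst p), g (snd p))"
        unfolding N_def by blast
      note lt = M_entry[OF p(1)]
      show "x \<in> E \<inter> (V1 \<times> V2)"
        using fV[OF lt(1)] gV[OF lt(2)] B0[OF fm[OF lt(1)] gn[OF lt(2)]] lt(3) p(2) by blast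
    qed
    moreover have "inj_on fst N"
      unfolding N_def by (rule inj_onI) (auto dest: f_eqD)
    moreover have "inj_on snd N"
      unfolding N_def by (rule inj_onI) (auto dest: g_eqD)
    ultimately have "matching (induced_subgraph G V1 V2) N"
      by (simp add: matching_iff_inj_on induced_subgraph_def G)
    then have "card N \<le> r"
      using mn finE by (subst (asm) matching_number_le_iff) (auto simp: induced_subgraph_def G)
    moreover have "card N = card M"
      unfolding N_def by (intro card_image inj_onI) (auto dest: f_eqD)
    ultimately show ?thesis using M(2) Ac by simp
  qed
  then show "d \<in> induced_subspace_orders m n S r"
    unfolding induced_subspace_orders_def mem_Collect_eq using L R d
    by (intro exI[of _ L] exI[of _ R] exI[of _ ?TL] exI[of _ ?TR]) simp
qed

section \<open>From induced subspaces to induced subgraphs\<close>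

text \<open>A spanning matrix has as many rows as the dimension of \<open>L\<close>, so its rows are
  independent and its transpose has trivial kernel.\<close>

lemma spanning_matrix_obtains_selection:
  fixes T :: "'a::field mat"
  assumes "spanning_matrix m L T" and s: "s = subspace_dim m L"
  obtains P f where "P \<in> carrier_mat s s" and "inj_on f {..<s}" and "\<And>a. a < s \<Longrightarrow> f a < m"
    and "P * (T * (selection_mat s m f)\<^sup>T) = 1\<^sub>m s"
proof -
  interpret vec_space "TYPE('a)" m .
  have T: "T \<in> carrier_mat s m" and L: "row_space T = L"
    using assms by (auto simp: spanning_matrix_def)
  have "rank T\<^sup>T = s" using L s subspace_dim_row_space by metis
  then have "\<And>v. v \<in> carrier_vec s \<Longrightarrow> T\<^sup>T *\<^sub>v v = 0\<^sub>v m \<Longrightarrow> v = 0\<^sub>v s"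
    using T trivial_kernel_if_rank_eq_dim_col[of "T\<^sup>T" s] by simp
  then show thesis
    using trivial_left_kernel_obtains_selection[OF T] that by blast
qed

text \<open>Keeps only the pivot columns numbered by \<open>a\<close>, those that a matching meets.
  After multiplication by \<open>P\<close> they form the transpose of the selection by
  \<open>a\<close>, which that selection inverts from the left.\<close>

lemma selection_sub_identity:
  fixes T :: "'a::field mat"
  assumes T: "T \<in> carrier_mat s m" and P: "P \<in> carrier_mat s s"
    and one: "P * (T * (selection_mat s m f)\<^sup>T) = 1\<^sub>m s"
    and a: "\<And>c. c < k \<Longrightarrow> a c < s" "inj_on a {..<k}"
  shows "(selection_mat k s a * P) * (T * (selection_mat k m (f \<circ> a))\<^sup>T) = 1\<^sub>m k"
proof -
  let ?A = "selection_mat k s a :: 'a mat"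
  let ?F = "selection_mat s m f :: 'a mat"
  have "selection_mat k m (f \<circ> a) = ?A * ?F"
    using selection_mat_comp[OF a(1), where 'a='a] by simp
  then have "(selection_mat k m (f \<circ> a) :: 'a mat)\<^sup>T = ?F\<^sup>T * ?A\<^sup>T"
    by (simp add: transpose_mult[of _ k s _ m])
  then have "T * (selection_mat k m (f \<circ> a))\<^sup>T = (T * ?F\<^sup>T) * ?A\<^sup>T"
    using T by (simp add: assoc_mult_mat[of _ s m _ s _ k])
  then have "(?A * P) * (T * (selection_mat k m (f \<circ> a))\<^sup>T) = ?A * (P * ((T * ?F\<^sup>T) * ?A\<^sup>T))"
    using T P by (simp only:) (intro assoc_mult_mat[of _ k s _ s _ k], auto)
  also have "P * ((T * ?F\<^sup>T) * ?A\<^sup>T) = (P * (T * ?F\<^sup>T)) * ?A\<^sup>T"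
    using T P by (intro assoc_mult_mat[symmetric, of _ s s _ s _ k]) auto
  also have "\<dots> = ?A\<^sup>T" using one by simp
  finally show ?thesis using selection_mat_right_inverse[OF a, where 'a='a] by (simp only:)
qed

text \<open>Entry \<open>(i, j)\<close> of the product counts the \<open>c\<close> with
  \<open>f c = i\<close> and \<open>g c = j\<close>. Injectivity of \<open>f\<close> leaves at most
  one, so the count is 0 or 1 in every characteristic.\<close>

lemma indicator_mat_eq_selection_product:
  fixes f g :: "nat \<Rightarrow> nat"
  assumes "inj_on f {..<k}"
  shows "mat m n (\<lambda>(i, j). if (i, j) \<in> (\<lambda>c. (f c, g c)) ` {..<k} then 1 else 0)
    = (selection_mat k m f)\<^sup>T * (selection_mat k n g :: 'a::field mat)"
proof (rule eq_matI)
  fix i j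
  assume "i < dim_row ((selection_mat k m f)\<^sup>T * (selection_mat k n g :: 'a mat))"
    and "j < dim_col ((selection_mat k m f)\<^sup>T * (selection_mat k n g :: 'a mat))"
  then have ij: "i < m" "j < n" by auto
  let ?I = "\<lambda>c. (if i = f c then 1 else 0) * (if j = g c then 1 else 0) :: 'a"
  have "((selection_mat k m f)\<^sup>T * (selection_mat k n g :: 'a mat)) $$ (i, j) = (\<Sum>c = 0..<k. ?I c)"
    using ij by (auto simp: selection_mat_def scalar_prod_def intro!: sum.cong)
  also have "\<dots> = (if (i, j) \<in> (\<lambda>c. (f c, g c)) ` {..<k} then 1 else 0)"
  proof (cases "(i, j) \<in> (\<lambda>c. (f c, g c)) ` {..<k}")
    case True
    then obtain c where c: "c < k" "i = f c" "j = g c" by auto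
    have "(\<Sum>x = 0..<k. ?I x) = (\<Sum>x = 0..<k. if x = c then 1 else 0)"
      using c assms by (intro sum.cong) (auto simp: inj_on_def)
    then show ?thesis using c True by simp
  next
    case False
    then have "(\<Sum>x = 0..<k. ?I x) = 0" by (intro sum.neutral) auto
    then show ?thesis using False by simp
  qed
  finally show "mat m n (\<lambda>(i, j). if (i, j) \<in> (\<lambda>c. (f c, g c)) ` {..<k} then 1 else 0) $$ (i, j)
      = ((selection_mat k m f)\<^sup>T * (selection_mat k n g :: 'a mat)) $$ (i, j)"
    using ij by simp
qed auto

lemma subspace_orders_subset:
  fixes S :: "'a::field mat set"
  assumes E: "E \<subseteq> {..<m} \<times> {..<n}"
    and G: "G = \<lparr>lverts = {..<m}, rverts = {..<n}, edges = E\<rparr>"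
    and S: "S = graph_mat_space m n E"
  shows "induced_subspace_orders m n S r \<subseteq> induced_subgraph_orders G r"
proof
  fix d assume "d \<in> induced_subspace_orders m n S r"
  then obtain L R TL TR where d: "d = subspace_dim m L + subspace_dim n R"
    and TL: "spanning_matrix m L TL" and TR: "spanning_matrix n R TR"
    and rk: "\<And>A. A \<in> induced_mat_space S TL TR \<Longrightarrow> mat_rank A \<le> r"
    by (auto simp: induced_subspace_orders_def)
  define s t where "s = subspace_dim m L" and "t = subspace_dim n R"
  have TLc: "TL \<in> carrier_mat s m" and TRc: "TR \<in> carrier_mat t n"
    using TL TR by (auto simp: spanning_matrix_def s_def t_def)
  obtain P f where P: "P \<in> carrier_mat s s" and finj: "inj_on f {..<s}"
    and f: "\<And>a. a < s \<Longrightarrow> f a < m" and P1: "P * (TL * (selection_mat s m f)\<^sup>T) = 1\<^sub>m s"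
    using spanning_matrix_obtains_selection[OF TL s_def] by metis
  obtain Q g where Q: "Q \<in> carrier_mat t t" and ginj: "inj_on g {..<t}"
    and g: "\<And>a. a < t \<Longrightarrow> g a < n" and Q1: "Q * (TR * (selection_mat t n g)\<^sup>T) = 1\<^sub>m t"
    using spanning_matrix_obtains_selection[OF TR t_def] by metis
  \<comment> \<open>The pivot columns serve as vertices; injectivity of \<open>f\<close> and
    \<open>g\<close> gives the two sides the sizes \<open>s\<close> and \<open>t\<close>, so the
    order is unchanged.\<close>
  let ?V1 = "f ` {..<s}" and ?V2 = "g ` {..<t}"
  have finE: "finite E" using E by (metis finite_SigmaI finite_lessThan finite_subset)
  have "card M \<le> r" if "matching (induced_subgraph G ?V1 ?V2) M" for M
  proof -
    have M: "M \<subseteq> E \<inter> (?V1 \<times> ?V2)" "inj_on fst M" "inj_on snd M"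
      using that by (auto simp: matching_iff_inj_on induced_subgraph_def G)
    define k where "k = card M"
    have "finite M" using M(1) finE finite_subset by blast
    then obtain e where e: "bij_betw e {..<k} M"
      using ex_bij_betw_nat_finite k_def by (auto simp: lessThan_atLeast0)
    then have eM: "e c \<in> M" if "c < k" for c using that by (auto simp: bij_betw_def)
    have einj: "inj_on e {..<k}" using e by (simp add: bij_betw_def)
    \<comment> \<open>\<open>a c\<close> and \<open>b c\<close> are the numbers, among the pivots,
      of the two ends of the edge \<open>e c\<close>.\<close>
    have "\<forall>c<k. \<exists>a<s. fst (e c) = f a" "\<forall>c<k. \<exists>b<t. snd (e c) = g b"
      using eM M(1) by fastforce+
    then obtain a b where a: "\<And>c. c < k \<Longrightarrow> a c < s" "\<And>c. c < k \<Longrightarrow> fst (e c) = f (a c)"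
      and b: "\<And>c. c < k \<Longrightarrow> b c < t" "\<And>c. c < k \<Longrightarrow> snd (e c) = g (b c)"
      by metis
    have fainj: "inj_on (f \<circ> a) {..<k}"
    proof (rule inj_onI)
      fix c c' assume c: "c \<in> {..<k}" "c' \<in> {..<k}" "(f \<circ> a) c = (f \<circ> a) c'"
      then have "fst (e c) = fst (e c')" using a(2) by simp
      then have "e c = e c'" using inj_onD[OF M(2)] eM c by auto
      then show "c = c'" using inj_onD[OF einj] c by auto
    qed
    have gbinj: "inj_on (g \<circ> b) {..<k}"
    proof (rule inj_onI)
      fix c c' assume c: "c \<in> {..<k}" "c' \<in> {..<k}" "(g \<circ> b) c = (g \<circ> b) c'"
      then have "snd (e c) = snd (e c')" using b(2) by simp
      then have "e c = e c'" using inj_onD[OF M(3)] eM c by auto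
      then show "c = c'" using inj_onD[OF einj] c by auto
    qed
    have ainj: "inj_on a {..<k}" and binj: "inj_on b {..<k}"
      using fainj gbinj inj_on_imageI2 by blast+
    have "M = e ` {..<k}" using e by (simp add: bij_betw_def)
    also have "\<dots> = (\<lambda>c. ((f \<circ> a) c, (g \<circ> b) c)) ` {..<k}"
      using a(2) b(2) by (intro image_cong) (auto simp: prod_eq_iff)
    finally have Meq: "M = (\<lambda>c. ((f \<circ> a) c, (g \<circ> b) c)) ` {..<k}" .
    let ?F = "selection_mat k m (f \<circ> a) :: 'a mat" and ?H = "selection_mat k n (g \<circ> b) :: 'a mat"
    \<comment> \<open>This is the 0/1 matrix of \<open>M\<close>, written as a product so that its
      factors can be absorbed by \<open>TL\<close> and \<open>TR\<close>.\<close>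
    define B where "B = ?F\<^sup>T * ?H"
    have Bc: "B \<in> carrier_mat m n" unfolding B_def by (rule mult_carrier_mat[of _ m k]) auto
    have "B \<in> S"
      using indicator_mat_in_graph_mat_space[OF \<open>finite M\<close>, of E m n] M(1)
      unfolding B_def S indicator_mat_eq_selection_product[OF fainj, symmetric] Meq[symmetric]
      by blast
    define A where "A = TL * B * TR\<^sup>T"
    have Ac: "A \<in> carrier_mat s t" using TLc TRc Bc by (simp add: A_def)
    have "mat_rank A \<le> r" using \<open>B \<in> S\<close> by (intro rk) (auto simp: induced_mat_space_def A_def)
    define X where "X = selection_mat k s a * P"
    define Y where "Y = selection_mat k t b * Q"
    have X: "X \<in> carrier_mat k s" unfolding X_def by (rule mult_carrier_mat[OF selection_mat_carrier P])
    have Y: "Y \<in> carrier_mat k t" unfolding Y_def by (rule mult_carrier_mat[OF selection_mat_carrier Q])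
    have X1: "X * (TL * ?F\<^sup>T) = 1\<^sub>m k"
      unfolding X_def by (rule selection_sub_identity[OF TLc P P1 a(1) ainj])
    have Y1: "Y * (TR * ?H\<^sup>T) = 1\<^sub>m k"
      unfolding Y_def by (rule selection_sub_identity[OF TRc Q Q1 b(1) binj])
    \<comment> \<open>\<open>U\<close> and \<open>W\<close> hold the columns of \<open>TL\<close>
      and \<open>TR\<close> at the ends of the edges of \<open>M\<close>. As
      \<open>A = U * W\<^sup>T\<close>, with \<open>X\<close> and \<open>Y\<close> left inverses of
      \<open>U\<close> and \<open>W\<close>, the product \<open>X * A * Y\<^sup>T\<close> is the
      identity of size \<open>k\<close>.\<close>
    define U where "U = TL * ?F\<^sup>T"
    define W where "W = TR * ?H\<^sup>T"
    have U: "U \<in> carrier_mat s k" using TLc by (simp add: U_def)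
    have W: "W \<in> carrier_mat t k" using TRc by (simp add: W_def)
    have Wt: "W\<^sup>T = ?H * TR\<^sup>T" using TRc by (simp add: W_def transpose_mult[of _ t n _ k])
    have "A = (U * ?H) * TR\<^sup>T"
      using TLc by (simp add: A_def B_def U_def assoc_mult_mat[of _ s m _ k _ n])
    also have "\<dots> = U * W\<^sup>T" using U TRc by (simp add: Wt assoc_mult_mat[of _ s k _ n _ t])
    finally have A: "A = U * W\<^sup>T" .
    have WY: "W\<^sup>T * Y\<^sup>T = 1\<^sub>m k"
      using Y1 W Y by (metis W_def transpose_mult transpose_one)
    have "A * Y\<^sup>T = U * (W\<^sup>T * Y\<^sup>T)"
      unfolding A using U W Y by (intro assoc_mult_mat[of _ s k _ t _ k]) auto
    then have "X * (A * Y\<^sup>T) = 1\<^sub>m k"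
      using WY U X1 by (simp add: U_def[symmetric])
    then have "k \<le> mat_rank A"
      using vec_space.rank_ge_if_identity_factor[OF Ac X, of "Y\<^sup>T"] Y Ac by simp
    then show ?thesis using \<open>mat_rank A \<le> r\<close> k_def by simp
  qed
  then have "matching_number (induced_subgraph G ?V1 ?V2) \<le> r"
    using finE by (subst matching_number_le_iff) (auto simp: induced_subgraph_def G)
  moreover have "?V1 \<subseteq> lverts G" "?V2 \<subseteq> rverts G" using f g by (auto simp: G)
  moreover have "d = bigraph_order (induced_subgraph G ?V1 ?V2)"
    using d finj ginj
    by (simp add: bigraph_order_def induced_subgraph_def card_image s_def[symmetric] t_def[symmetric])
  ultimately show "d \<in> induced_subgraph_orders G r"
    unfolding induced_subgraph_orders_def by blast
qed

theorem theorem1p7: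
  fixes m n r :: nat and E :: "(nat \<times> nat) set"
    and G :: "(nat, nat) bigraph" and S :: "'a::field mat set"
  assumes "m \<le> n"
    and "E \<subseteq> {..<m} \<times> {..<n}"
    and "G = \<lparr>lverts = {..<m}, rverts = {..<n}, edges = E\<rparr>"
    and "S = graph_mat_space m n E"
    and "1 \<le> r" and "r \<le> m"
  shows "Max (induced_subgraph_orders G r) = Max (induced_subspace_orders m n S r)"
  using subgraph_orders_subset[OF assms(2-4)] subspace_orders_subset[OF assms(2-4)]
  by (metis subset_antisym)

end
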